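(* Let $p,q\in(1,\infty)$ and $r\in[1,\infty)$ be such that $\frac{1}{r}=\frac{1}{p}+\frac{1}{q}$. Then, for every natural number $n$, $$\Pi_{q}\circ\mathcal{C}_{\Pi_{p}}^{n}\subset\mathcal{C}_{\Pi_{r}}^{n}.$$ That is, for all Banach spaces $X_1,\dots,X_n,Y,Z$, if $T\in\mathcal{C}_{\Pi_p}^n(X_1,\dots,X_n;Y)$ and $u\in\Pi_q(Y;Z)$, then $u\circ T\in\mathcal{C}_{\Pi_r}^n(X_1,\dots,X_n;Z)$.
   Context: All Banach spaces are over $\mathbb{K}=\mathbb{R}$ or $\mathbb{C}$. $\mathcal{L}(X_1,\dots,X_n;Y)$ is the space of continuous $n$-linear operators $X_1\times\cdots\times X_n\to Y$. For a Banach space $X$ with dual $X^*$, $\ell_p(X)$ is the space of sequences $(x_j)$ in $X$ with $\sum_j\|x_j\|^p<\infty$, and $\ell_p^w(X)$ is the space of sequences $(x_j)$ in $X$ with $\sup_{\varphi\in B_{X^*}}\sum_j|\varphi(x_j)|^p<\infty$. For $1\le p<\infty$, $\Pi_p(X;Y)$ is the set of absolutely $p$-summing linear operators: continuous linear $u:X\to Y$ such that $(u(x_j))_{j}\in\ell_p(Y)$ whenever $(x_j)_{j}\in\ell_p^w(X)$. For an operator ideal $\mathcal{I}$, the class $\mathcal{C}_{\mathcal{I}}^n$ is defined as follows: an $n$-linear operator $T:X_1\times\cdots\times X_n\to Y$ belongs to $\mathcal{C}_{\mathcal{I}}^n(X_1,\dots,X_n;Y)$ if and only if there are a Banach space $W$,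 a map $A\in\mathcal{L}(X_1,\dots,X_n;W)$ and $v\in\mathcal{I}(W;Y)$ such that $T(x_1,\dots,x_n)=v(A(x_1,\dots,x_n))$ for all $x_i\in X_i$. *)

theory Defs
  imports "HOL-Analysis.Analysis" "HOL-Algebra.Module"
begin

section \<open>Banach spaces with explicit carriers\<close>

text \<open>
  The spaces are records on carrier sets rather than members of a type class, because a finite
  family of unrelated Banach spaces has to be indexed by a natural number, and because a Banach
  space has to be quantified existentially. The scalar field is the subset \<open>K\<close> of the complex
  numbers, to be taken as \<open>\<real>\<close> or \<open>UNIV\<close>; for \<open>K = \<real>\<close> the value of \<open>smult\<close> at
  non-real scalars is irrelevant. The fields \<open>mult\<close> and \<open>one\<close> inherited from the library
  record \<open>module\<close> play no role, except in the scalar field itself.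
\<close>

record 'a normed_module = "(complex, 'a) module" +
  vnorm :: "'a \<Rightarrow> real" (\<open>(\<open>open_block notation=\<open>mixfix vnorm\<close>\<close>\<parallel>_\<parallel>\<index>)\<close>)

text \<open>
  \<open>K\<close> serves both as the coefficient ring and as the one-dimensional Banach space in which
  functionals take their values.
\<close>

definition scalars :: "complex set \<Rightarrow> complex normed_module" where
  "scalars K = \<lparr>carrier = K, mult = (*), one = 1, zero = 0, add = (+), smult = (*), vnorm = cmod\<rparr>"

text \<open>
  The locale \<open>Metric_space\<close> requires nonnegativity and symmetry also outside the carrier,
  hence the default value.
\<close>

definition vdist :: "'a normed_module \<Rightarrow> 'a \<Rightarrow> 'a \<Rightarrow> real" where
  "vdist V x y = (if x \<in> carrier V \<and> y \<in> carrier V then \<parallel>x \<ominus>\<^bsub>V\<^esub> y\<parallel>\<^bsub>V\<^esub> else 0)"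

definition vtopology :: "'a normed_module \<Rightarrow> 'a topology" where
  "vtopology V = Metric_space.mtopology (carrier V) (vdist V)"

locale banach_space = Module.module "scalars K" V
  for K :: "complex set" and V :: "'a normed_module" (structure) +
  assumes vnorm_eq_0: "x \<in> carrier V \<Longrightarrow> \<parallel>x\<parallel> = 0 \<longleftrightarrow> x = \<zero>"
    and vnorm_smult: "\<lbrakk>c \<in> K; x \<in> carrier V\<rbrakk> \<Longrightarrow> \<parallel>c \<odot> x\<parallel> = cmod c * \<parallel>x\<parallel>"
    and vnorm_triangle: "\<lbrakk>x \<in> carrier V; y \<in> carrier V\<rbrakk> \<Longrightarrow> \<parallel>x \<oplus> y\<parallel> \<le> \<parallel>x\<parallel> + \<parallel>y\<parallel>"
    and complete: "Metric_space.mcomplete (carrier V) (vdist V)"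

section \<open>Continuous linear and multilinear operators\<close>

text \<open>
  Operators are HOL functions of which only the values on the relevant carrier matter.
\<close>

definition linear_op :: "complex set \<Rightarrow> 'a normed_module \<Rightarrow> 'b normed_module \<Rightarrow> ('a \<Rightarrow> 'b) \<Rightarrow> bool" where
  "linear_op K V W f \<longleftrightarrow>
     f \<in> carrier V \<rightarrow> carrier W \<and>
     (\<forall>x\<in>carrier V. \<forall>y\<in>carrier V. f (x \<oplus>\<^bsub>V\<^esub> y) = f x \<oplus>\<^bsub>W\<^esub> f y) \<and>
     (\<forall>c\<in>K. \<forall>x\<in>carrier V. f (c \<odot>\<^bsub>V\<^esub> x) = c \<odot>\<^bsub>W\<^esub> f x)"

definition bounded_ops :: "complex set \<Rightarrow> 'a normed_module \<Rightarrow> 'b normed_module \<Rightarrow> ('a \<Rightarrow> 'b) set" where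
  "bounded_ops K V W = {f. linear_op K V W f \<and> continuous_map (vtopology V) (vtopology W) f}"

definition op_norm :: "'a normed_module \<Rightarrow> 'b normed_module \<Rightarrow> ('a \<Rightarrow> 'b) \<Rightarrow> real" where
  "op_norm V W f = (SUP x\<in>{x \<in> carrier V. \<parallel>x\<parallel>\<^bsub>V\<^esub> \<le> 1}. \<parallel>f x\<parallel>\<^bsub>W\<^esub>)"

definition dual_ball :: "complex set \<Rightarrow> 'a normed_module \<Rightarrow> ('a \<Rightarrow> complex) set" where
  "dual_ball K V = {\<phi> \<in> bounded_ops K V (scalars K). op_norm V (scalars K) \<phi> \<le> 1}"

text \<open>
  Points of \<open>X 1 \<times> \<dots> \<times> X n\<close> are functions in \<open>\<Pi>\<^sub>E i\<in>{1..n}. carrier (X i)\<close>.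
\<close>

definition multilinear_op ::
    "complex set \<Rightarrow> nat \<Rightarrow> (nat \<Rightarrow> 'a normed_module) \<Rightarrow> 'b normed_module \<Rightarrow> ((nat \<Rightarrow> 'a) \<Rightarrow> 'b) \<Rightarrow> bool" where
  "multilinear_op K n X W T \<longleftrightarrow>
     T \<in> (\<Pi>\<^sub>E i\<in>{1..n}. carrier (X i)) \<rightarrow> carrier W \<and>
     (\<forall>x\<in>(\<Pi>\<^sub>E i\<in>{1..n}. carrier (X i)). \<forall>i\<in>{1..n}. linear_op K (X i) W (\<lambda>t. T (x(i := t))))"

definition bounded_multilinear_ops ::
    "complex set \<Rightarrow> nat \<Rightarrow> (nat \<Rightarrow> 'a normed_module) \<Rightarrow> 'b normed_module \<Rightarrow> ((nat \<Rightarrow> 'a) \<Rightarrow> 'b) set" where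
  "bounded_multilinear_ops K n X W =
     {T. multilinear_op K n X W T \<and>
         continuous_map (product_topology (\<lambda>i. vtopology (X i)) {1..n}) (vtopology W) T}"

section \<open>Absolutely summing operators\<close>

definition lp_seqs :: "real \<Rightarrow> 'a normed_module \<Rightarrow> (nat \<Rightarrow> 'a) set" where
  "lp_seqs p V = {x. (\<forall>j. x j \<in> carrier V) \<and> summable (\<lambda>j. \<parallel>x j\<parallel>\<^bsub>V\<^esub> powr p)}"

definition weak_lp_seqs :: "complex set \<Rightarrow> real \<Rightarrow> 'a normed_module \<Rightarrow> (nat \<Rightarrow> 'a) set" where
  "weak_lp_seqs K p V =
     {x. (\<forall>j. x j \<in> carrier V) \<and>
         (SUP \<phi>\<in>dual_ball K V. \<Sum>j. ennreal (cmod (\<phi> (x j)) powr p)) < \<infinity>}"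

definition summing_ops ::
    "complex set \<Rightarrow> real \<Rightarrow> 'a normed_module \<Rightarrow> 'b normed_module \<Rightarrow> ('a \<Rightarrow> 'b) set" where
  "summing_ops K p V W =
     {u \<in> bounded_ops K V W. \<forall>x\<in>weak_lp_seqs K p V. (\<lambda>j. u (x j)) \<in> lp_seqs p W}"

section \<open>Multilinear operators factoring through an operator ideal\<close>

text \<open>
  The parameter \<open>I\<close> is the ideal, given by its components \<open>I W Y\<close>. Since HOL cannot quantify
  over types inside a formula, the carrier of the intermediate Banach space \<open>W\<close> ranges over the
  subsets of the type \<open>'w\<close>, a universe which is fixed by the type of \<open>I\<close>. It is an arbitrary
  type variable in what follows.
\<close>

definition ideal_factor_ops ::
    "complex set \<Rightarrow> ('w normed_module \<Rightarrow> 'y normed_module \<Rightarrow> ('w \<Rightarrow> 'y) set) \<Rightarrow> nat \<Rightarrow>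
     (nat \<Rightarrow> 'x normed_module) \<Rightarrow> 'y normed_module \<Rightarrow> ((nat \<Rightarrow> 'x) \<Rightarrow> 'y) set" where
  "ideal_factor_ops K I n X Y =
     {T. multilinear_op K n X Y T \<and>
         (\<exists>W A v. banach_space K W \<and> A \<in> bounded_multilinear_ops K n X W \<and> v \<in> I W Y \<and>
            (\<forall>x\<in>(\<Pi>\<^sub>E i\<in>{1..n}. carrier (X i)). T x = v (A x)))}"

section \<open>Consistency of the definitions\<close>

lemma (in banach_space) neg_one_scalar: "uminus 1 \<in> K" "\<ominus>\<^bsub>scalars K\<^esub> \<one>\<^bsub>scalars K\<^esub> = uminus 1"
proof -
  have "\<ominus>\<^bsub>scalars K\<^esub> \<one>\<^bsub>scalars K\<^esub> \<in> carrier (scalars K)"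
    and "\<ominus>\<^bsub>scalars K\<^esub> \<one>\<^bsub>scalars K\<^esub> \<oplus>\<^bsub>scalars K\<^esub> \<one>\<^bsub>scalars K\<^esub> = \<zero>\<^bsub>scalars K\<^esub>"
    by (simp_all add: R.l_neg)
  then show "\<ominus>\<^bsub>scalars K\<^esub> \<one>\<^bsub>scalars K\<^esub> = uminus 1" and "uminus 1 \<in> K"
    unfolding eq_neg_iff_add_eq_0[of _ "1 :: complex"]
    by (simp_all add: scalars_def) (metis eq_neg_iff_add_eq_0)
qed

lemma (in banach_space) vnorm_minus_commute:
  assumes "x \<in> carrier V" "y \<in> carrier V"
  shows "\<parallel>x \<ominus> y\<parallel> = \<parallel>y \<ominus> x\<parallel>"
proof -
  have "(uminus 1) \<odot> (y \<ominus> x) = \<ominus> (y \<ominus> x)"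
    using smult_l_minus[of "\<one>\<^bsub>scalars K\<^esub>" "y \<ominus> x"] assms neg_one_scalar by simp
  also have "\<dots> = x \<ominus> y"
    using assms by (simp add: M.minus_eq M.minus_add M.a_comm)
  finally show ?thesis
    using vnorm_smult[of "uminus 1" "y \<ominus> x"] assms neg_one_scalar by simp
qed

lemma (in banach_space) Metric_space_vdist: "Metric_space (carrier V) (vdist V)"
proof
  have tri: "\<parallel>x \<ominus> z\<parallel> \<le> \<parallel>x \<ominus> y\<parallel> + \<parallel>y \<ominus> z\<parallel>"
    if "x \<in> carrier V" "y \<in> carrier V" "z \<in> carrier V" for x y z
  proof -
    have "(x \<ominus> y) \<oplus> (y \<ominus> z) = x \<ominus> z"
      using that by (simp add: M.minus_eq M.a_assoc M.r_neg1)
    then show ?thesis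
      using vnorm_triangle[of "x \<ominus> y" "y \<ominus> z"] that by simp
  qed
  have diff_0: "x \<ominus> y = \<zero> \<longleftrightarrow> x = y" if "x \<in> carrier V" "y \<in> carrier V" for x y
  proof
    assume "x \<ominus> y = \<zero>"
    then have "x = \<ominus> (\<ominus> y)"
      using that M.minus_equality[of x "\<ominus> y"] by (simp add: M.minus_eq)
    then show "x = y"
      using that by simp
  qed (use that in \<open>simp add: M.minus_eq M.r_neg\<close>)
  have self: "\<parallel>x \<ominus> x\<parallel> = 0" if "x \<in> carrier V" for x
    using that vnorm_eq_0[of "x \<ominus> x"] diff_0 by simp
  show "0 \<le> vdist V x y" for x y
    using tri[of x y x] self[of x] vnorm_minus_commute[of x y] by (auto simp: vdist_def)
  show "vdist V x y = vdist V y x" for x y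
    using vnorm_minus_commute by (simp add: vdist_def)
  show "vdist V x y = 0 \<longleftrightarrow> x = y" if "x \<in> carrier V" "y \<in> carrier V" for x y
    using that vnorm_eq_0[of "x \<ominus> y"] diff_0 by (simp add: vdist_def)
  show "vdist V x z \<le> vdist V x y + vdist V y z"
    if "x \<in> carrier V" "y \<in> carrier V" "z \<in> carrier V" for x y z
    using that tri by (simp add: vdist_def)
qed

lemma banach_space_scalars:
  assumes K: "K = \<real> \<or> K = UNIV"
  shows "banach_space K (scalars K)"
proof -
  have cl: "0 \<in> K" "1 \<in> K" "\<And>x y. x \<in> K \<Longrightarrow> y \<in> K \<Longrightarrow> x + y \<in> K"
    "\<And>x y. x \<in> K \<Longrightarrow> y \<in> K \<Longrightarrow> x * y \<in> K" "\<And>x. x \<in> K \<Longrightarrow> - x \<in> K"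
    using K by auto
  have ab: "abelian_group (scalars K)"
  proof (rule abelian_groupI)
    show "\<exists>y\<in>carrier (scalars K). y \<oplus>\<^bsub>scalars K\<^esub> x = \<zero>\<^bsub>scalars K\<^esub>"
      if "x \<in> carrier (scalars K)" for x
      by (rule bexI[of _ "- x"]) (use that cl in \<open>auto simp: scalars_def\<close>)
  qed (use cl in \<open>auto simp: scalars_def\<close>)
  have cr: "cring (scalars K)"
    by (rule cringI[OF ab])
      (use cl in \<open>auto simp: scalars_def algebra_simps intro!: comm_monoidI\<close>)
  interpret Module.module "scalars K" "scalars K"
    by (rule moduleI[OF cr ab]) (use cl in \<open>auto simp: scalars_def algebra_simps\<close>)
  have neg: "\<ominus>\<^bsub>scalars K\<^esub> y = - y" if "y \<in> K" for y
    by (rule R.minus_equality) (use that cl in \<open>auto simp: scalars_def\<close>)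
  have d: "vdist (scalars K) x y = dist x y" if "x \<in> K" "y \<in> K" for x y
    using that neg by (simp add: vdist_def R.minus_eq) (simp add: scalars_def dist_norm)
  have "Metric_space K (vdist (scalars K))"
  proof
    show "0 \<le> vdist (scalars K) x y" for x y
      using d[of x y] by (cases "x \<in> K \<and> y \<in> K") (auto simp: vdist_def scalars_def)
    show "vdist (scalars K) x y = vdist (scalars K) y x" for x y
      using d[of x y] d[of y x]
      by (cases "x \<in> K \<and> y \<in> K") (auto simp: vdist_def scalars_def dist_commute)
  qed (auto simp: d dist_triangle)
  then interpret D: Metric_space K "vdist (scalars K)" .
  have "closed K"
    using K closed_complex_Reals by auto
  then have "complete K"
    by (simp add: complete_eq_closed)
  have "D.mcomplete"
    unfolding D.mcomplete_def
  proof (intro allI impI)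
    fix s assume s: "D.MCauchy s"
    then have sK: "range s \<subseteq> K"
      by (simp add: D.MCauchy_def)
    then have dd: "vdist (scalars K) (s m) (s n) = dist (s m) (s n)" for m n
      by (intro d) auto
    have "Cauchy s"
      using s unfolding D.MCauchy_def dd Cauchy_def by meson
    then obtain l where l: "l \<in> K" "s \<longlonglongrightarrow> l"
      using \<open>complete K\<close> sK unfolding complete_def by blast
    have "limitin D.mtopology s l sequentially"
      unfolding D.limit_metric_sequentially
    proof (intro conjI allI impI l(1))
      fix e :: real assume "e > 0"
      then obtain N where "\<forall>n\<ge>N. dist (s n) l < e"
        using l(2) by (meson LIMSEQ_def)
      then show "\<exists>N. \<forall>n\<ge>N. s n \<in> K \<and> vdist (scalars K) (s n) l < e"
        using sK l(1) by (intro exI[of _ N]) (auto simp: d image_subset_iff)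
    qed
    then show "\<exists>l. limitin D.mtopology s l sequentially" ..
  qed
  moreover have "carrier (scalars K) = K"
    by (simp add: scalars_def)
  ultimately show ?thesis
    by unfold_locales (auto simp: scalars_def norm_mult norm_triangle_ineq)
qed

end

theory Submission
  imports Defs
begin

text \<open>
  If \<open>T\<close> factors as \<open>v \<circ> A\<close> with \<open>v\<close> absolutely \<open>p\<close>-summing, then \<open>u \<circ> T\<close> factors as
  \<open>(u \<circ> v) \<circ> A\<close> through the same space. So the statement reduces to Pietsch's composition theorem
  for linear operators, \<open>summing_ops_comp\<close>: the composition of a \<open>p\<close>-summing and a \<open>q\<close>-summing
  operator is \<open>r\<close>-summing if \<open>1/r = 1/p + 1/q\<close>.

  The composition theorem is usually derived from a dominating probability measure on the weak*
  compact dual ball. The proof here stays with finite families. The definition of summing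
  operators by sequences implies an inequality with a uniform constant for finite families, because
  counterexamples to all constants can be glued to one sequence (\<open>summing_ops_finitely_summing\<close>).
  For finitely many vectors \<open>y\<^sub>j = v x\<^sub>j\<close>, a dominating measure for \<open>u\<close> can be taken uniform on finitely many functionals \<open>\<psi>\<^sub>k\<close>, at the cost of a factor
  (\<open>finite_Pietsch_domination\<close>): \<open>\<parallel>u y\<^sub>j\<parallel>\<^sup>q\<close> is at most a constant times the average
  \<open>b\<^sub>j\<close> of \<open>|\<psi>\<^sub>k y\<^sub>j|\<^sup>q\<close> over \<open>k\<close>. It exists by a minimax argument, which is carried out as a
  repeated game (\<open>averages_approach\<close>).

  It remains to bound \<open>S = \<Sum>\<^sub>j b\<^sub>j\<^bsup>r/q\<^esup>\<close>, in \<open>finite_factorization_estimate\<close>. The idea is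
  to test the \<open>p\<close>-summing inequality of \<open>v\<close> on one vector \<open>z\<^sub>k\<close> for every \<open>\<psi>\<^sub>k\<close>, namely the
  combination of the \<open>x\<^sub>j\<close> on which \<open>\<psi>\<^sub>k \<circ> v\<close> attains equality in Hoelder's inequality after
  \<open>y\<^sub>j\<close> is divided by \<open>\<sigma>\<^sub>j = b\<^sub>j\<^bsup>1/(p+q)\<^esup>\<close>. Then \<open>S\<close> is the average of the numbers \<open>\<psi>\<^sub>k (v z\<^sub>k)\<close>,
  and two applications of Hoelder's inequality with the exponents \<open>1/p\<close>, \<open>1/q\<close> and \<open>1 - 1/r\<close>
  lead to \<open>S \<le> C S\<^bsup>1 - 1/r\<^esup>\<close>, which bounds \<open>S\<close>.
\<close>

section \<open>Hoelder's inequality with three exponents\<close>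

text \<open>
  Each logarithm lies below its tangent at the weighted arithmetic mean, and the linear terms
  cancel in the weighted sum of the tangents.
\<close>

lemma weighted_AM_GM_three:
  fixes a b c x y z :: real
  assumes w: "a \<ge> 0" "b \<ge> 0" "c \<ge> 0" "a + b + c = 1"
    and nn: "x \<ge> 0" "y \<ge> 0" "z \<ge> 0"
  shows "x powr a * y powr b * z powr c \<le> a * x + b * y + c * z"
proof (cases "x = 0 \<or> y = 0 \<or> z = 0")
  case True
  then show ?thesis using w nn by auto
next
  case False
  then have pos: "x > 0" "y > 0" "z > 0" using nn by auto
  define m where "m = a * x + b * y + c * z"
  have "m > 0"
  proof -
    have "a > 0 \<or> b > 0 \<or> c > 0" using w by linarith
    then show ?thesis
      unfolding m_def using pos w
      by (elim disjE) (simp_all add: add_pos_nonneg add_nonneg_pos)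
  qed
  have tangent: "w * ln t \<le> w * (ln m + (t / m - 1))" if "t > 0" "w \<ge> 0" for t w
  proof -
    have "ln (t / m) \<le> t / m - 1" using that \<open>m > 0\<close> by (intro ln_le_minus_one) simp
    then have "ln t \<le> ln m + (t / m - 1)" using that \<open>m > 0\<close> by (simp add: ln_div)
    then show ?thesis using that by (intro mult_left_mono)
  qed
  have "a * ln x + b * ln y + c * ln z
      \<le> a * (ln m + (x / m - 1)) + b * (ln m + (y / m - 1)) + c * (ln m + (z / m - 1))"
    by (intro add_mono tangent pos w)
  also have "\<dots> = (a + b + c) * (ln m - 1) + (a * x + b * y + c * z) / m"
    by (simp add: algebra_simps add_divide_distrib)
  also have "\<dots> = ln m"
    using \<open>m > 0\<close> w(4) by (simp add: m_def[symmetric])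
  finally have "exp (a * ln x + b * ln y + c * ln z) \<le> exp (ln m)" by simp
  then show ?thesis
    using pos \<open>m > 0\<close> by (simp add: powr_def exp_add m_def)
qed

text \<open>
  Normalized to sums \<open>1\<close>, this is the sum over \<open>i\<close> of the previous inequality. Since
  \<open>0 powr 0 = 0\<close>, a summand with a zero factor vanishes even if the exponent there is \<open>0\<close>, so that
  the degenerate case \<open>c = 0\<close>, which occurs below for \<open>r = 1\<close>, is included.
\<close>

lemma Holder_three_sum:
  fixes a b c :: real and x y z :: "'i \<Rightarrow> real"
  assumes w: "a \<ge> 0" "b \<ge> 0" "c \<ge> 0" "a + b + c = 1"
    and nn: "\<And>i. i \<in> I \<Longrightarrow> x i \<ge> 0" "\<And>i. i \<in> I \<Longrightarrow> y i \<ge> 0" "\<And>i. i \<in> I \<Longrightarrow> z i \<ge> 0"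
  shows "(\<Sum>i\<in>I. x i powr a * y i powr b * z i powr c)
    \<le> (\<Sum>i\<in>I. x i) powr a * (\<Sum>i\<in>I. y i) powr b * (\<Sum>i\<in>I. z i) powr c"
proof (cases "finite I \<and> sum x I \<noteq> 0 \<and> sum y I \<noteq> 0 \<and> sum z I \<noteq> 0")
  case False
  have "x i = 0 \<or> y i = 0 \<or> z i = 0" if "finite I" "i \<in> I" for i
    using False that(1) sum_nonneg_eq_0_iff[OF that(1), of x]
      sum_nonneg_eq_0_iff[OF that(1), of y] sum_nonneg_eq_0_iff[OF that(1), of z] nn that(2)
    by metis
  then have "(\<Sum>i\<in>I. x i powr a * y i powr b * z i powr c) = 0"
    by (cases "finite I") (auto intro!: sum.neutral)
  then show ?thesis by simp
next
  case True
  define X Y Z where "X = sum x I" and "Y = sum y I" and "Z = sum z I"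
  have pos: "X > 0" "Y > 0" "Z > 0"
    using True sum_nonneg[of I x] sum_nonneg[of I y] sum_nonneg[of I z] nn
    by (simp_all add: X_def Y_def Z_def order_less_le)
  define P where "P = X powr a * Y powr b * Z powr c"
  have "(\<Sum>i\<in>I. (x i / X) powr a * (y i / Y) powr b * (z i / Z) powr c)
      \<le> (\<Sum>i\<in>I. a * (x i / X) + b * (y i / Y) + c * (z i / Z))"
    using pos nn by (intro sum_mono weighted_AM_GM_three w) auto
  also have "\<dots> = a * (sum x I / X) + b * (sum y I / Y) + c * (sum z I / Z)"
    by (simp only: sum.distrib sum_distrib_left[symmetric] sum_divide_distrib[symmetric])
  also have "\<dots> = 1"
    using pos w by (simp add: X_def[symmetric] Y_def[symmetric] Z_def[symmetric])
  finally have "(\<Sum>i\<in>I. (x i / X) powr a * (y i / Y) powr b * (z i / Z) powr c) * P \<le> 1 * P"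
    by (rule mult_right_mono) (simp add: P_def)
  moreover have "(\<Sum>i\<in>I. x i powr a * y i powr b * z i powr c)
      = (\<Sum>i\<in>I. (x i / X) powr a * (y i / Y) powr b * (z i / Z) powr c) * P"
    unfolding sum_distrib_right using pos nn
    by (intro sum.cong) (simp_all add: powr_divide P_def)
  ultimately show ?thesis
    unfolding P_def X_def Y_def Z_def by simp
qed

section \<open>A minimax principle by repeated play\<close>

text \<open>
  A one-sided form of Blackwell's approachability theorem: if every nonnegative weighting \<open>w\<close> of the
  coordinates has a response \<open>t\<close> whose payoff vector \<open>f t\<close> is at least as large as \<open>a\<close> in weighted
  sum, then some uniform average of payoff vectors is almost above \<open>a\<close> in every coordinate. The
  strategy is to weight the coordinates by the positive parts of the accumulated deficits
  \<open>D n = \<Sum>\<^sub>k\<^sub><\<^sub>n (a - f (t k))\<close>. The response makes the cross term in the square of the next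
  positive part nonpositive, so this square grows at most linearly in \<open>n\<close>, and the positive part
  of the average deficit tends to \<open>0\<close>.
\<close>

lemma averages_approach:
  fixes a :: "'i \<Rightarrow> real" and f :: "'k \<Rightarrow> 'i \<Rightarrow> real"
  assumes I: "finite I" "I \<noteq> {}"
    and bd: "\<And>t i. t \<in> S \<Longrightarrow> i \<in> I \<Longrightarrow> \<bar>f t i\<bar> \<le> M"
    and resp: "\<And>w. (\<And>i. i \<in> I \<Longrightarrow> w i \<ge> 0) \<Longrightarrow> (\<exists>i\<in>I. w i > 0) \<Longrightarrow>
      \<exists>t\<in>S. (\<Sum>i\<in>I. w i * a i) \<le> (\<Sum>i\<in>I. w i * f t i)"
    and "\<epsilon> > 0"
  shows "\<exists>n>0. \<exists>t. (\<forall>k<n. t k \<in> S) \<and> (\<forall>i\<in>I. a i - \<epsilon> \<le> (\<Sum>k<n. f (t k) i) / real n)"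
proof -
  define D where "D t n i = (\<Sum>k<n. a i - f (t k) i)" for t :: "nat \<Rightarrow> 'k" and n :: nat and i
  define L where "L = (\<Sum>i\<in>I. (\<bar>a i\<bar> + M)\<^sup>2)"
  have L0: "L \<ge> 0" by (simp add: L_def sum_nonneg)
  have play: "\<exists>t. (\<forall>k<n. t k \<in> S) \<and> (\<Sum>i\<in>I. (max 0 (D t n i))\<^sup>2) \<le> real n * L" for n
  proof (induction n)
    case 0
    then show ?case by (simp add: D_def)
  next
    case (Suc n)
    then obtain t where t: "\<forall>k<n. t k \<in> S" "(\<Sum>i\<in>I. (max 0 (D t n i))\<^sup>2) \<le> real n * L" by auto
    define w where "w i = max 0 (D t n i)" for i
    have w0: "w i \<ge> 0" for i by (simp add: w_def)
    obtain s where s: "s \<in> S" "(\<Sum>i\<in>I. w i * a i) \<le> (\<Sum>i\<in>I. w i * f s i)"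
    proof (cases "\<exists>i\<in>I. w i > 0")
      case True
      then show ?thesis using resp[of w] w0 that by auto
    next
      case False
      (* No coordinate is in deficit, so that any response will do. *)
      then have z: "w i = 0" if "i \<in> I" for i using w0[of i] that by force
      obtain s where "s \<in> S" using resp[of "\<lambda>_. 1"] I by auto
      then show ?thesis using that[of s] z by simp
    qed
    define t' where "t' = t(n := s)"
    have D': "D t' (Suc n) i = D t n i + (a i - f s i)" for i
      by (simp add: D_def t'_def)
    have step: "(max 0 (D t' (Suc n) i))\<^sup>2 \<le> (w i)\<^sup>2 + 2 * (w i * a i - w i * f s i) + (\<bar>a i\<bar> + M)\<^sup>2"
      if "i \<in> I" for i
    proof -
      have "max 0 (D t' (Suc n) i) \<le> \<bar>w i + (a i - f s i)\<bar>"
        unfolding D' w_def by linarith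
      then have "(max 0 (D t' (Suc n) i))\<^sup>2 \<le> \<bar>w i + (a i - f s i)\<bar>\<^sup>2"
        by (intro power_mono) auto
      also have "\<dots> = (w i)\<^sup>2 + 2 * (w i * a i - w i * f s i) + (a i - f s i)\<^sup>2"
        by (simp add: power2_eq_square algebra_simps)
      also have "\<bar>a i - f s i\<bar>\<^sup>2 \<le> (\<bar>a i\<bar> + M)\<^sup>2"
        using bd[OF s(1) that] by (intro power_mono) linarith+
      then have "(a i - f s i)\<^sup>2 \<le> (\<bar>a i\<bar> + M)\<^sup>2" by simp
      finally show ?thesis by simp
    qed
    have "(\<Sum>i\<in>I. (max 0 (D t' (Suc n) i))\<^sup>2)
        \<le> (\<Sum>i\<in>I. (w i)\<^sup>2 + 2 * (w i * a i - w i * f s i) + (\<bar>a i\<bar> + M)\<^sup>2)"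
      by (intro sum_mono step)
    also have "\<dots> = (\<Sum>i\<in>I. (w i)\<^sup>2) + 2 * ((\<Sum>i\<in>I. w i * a i) - (\<Sum>i\<in>I. w i * f s i)) + L"
      by (simp add: sum.distrib sum_subtractf sum_distrib_left L_def)
    also have "\<dots> \<le> real n * L + 2 * 0 + L"
      using s(2) t(2) unfolding w_def by (intro add_mono mult_left_mono) auto
    finally have "(\<Sum>i\<in>I. (max 0 (D t' (Suc n) i))\<^sup>2) \<le> real (Suc n) * L"
      by (simp add: algebra_simps)
    moreover have "\<forall>k<Suc n. t' k \<in> S" using t(1) s(1) by (auto simp: t'_def less_Suc_eq)
    ultimately show ?case by blast
  qed
  obtain n :: nat where n: "L / \<epsilon>\<^sup>2 < real n" "n > 0"
    using reals_Archimedean2[of "max 0 (L / \<epsilon>\<^sup>2)"] by (metis max_less_iff_conj of_nat_0_less_iff)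
  obtain t where t: "\<forall>k<n. t k \<in> S" "(\<Sum>i\<in>I. (max 0 (D t n i))\<^sup>2) \<le> real n * L"
    using play by blast
  have "a i - \<epsilon> \<le> (\<Sum>k<n. f (t k) i) / real n" if "i \<in> I" for i
  proof -
    have "(max 0 (D t n i))\<^sup>2 \<le> (\<Sum>i\<in>I. (max 0 (D t n i))\<^sup>2)"
      using I(1) that by (intro member_le_sum) auto
    also have "\<dots> \<le> real n * L" by (fact t)
    also have "\<dots> \<le> real n * (real n * \<epsilon>\<^sup>2)"
      using n \<open>\<epsilon> > 0\<close> by (intro mult_left_mono) (auto simp: field_simps)
    also have "\<dots> = (real n * \<epsilon>)\<^sup>2" by (simp add: power2_eq_square)
    finally have "max 0 (D t n i) \<le> real n * \<epsilon>"
      by (rule power2_le_imp_le) (use \<open>\<epsilon> > 0\<close> in simp)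
    then have "real n * a i - (\<Sum>k<n. f (t k) i) \<le> real n * \<epsilon>"
      by (simp add: D_def sum_subtractf)
    then show ?thesis using n(2) by (simp add: field_simps)
  qed
  then show ?thesis using n(2) t(1) by blast
qed

section \<open>Functionals and linear operators on Banach spaces\<close>

lemma scalars_simps [simp]:
  "carrier (scalars K) = K" "\<zero>\<^bsub>scalars K\<^esub> = 0" "\<one>\<^bsub>scalars K\<^esub> = 1"
  "x \<oplus>\<^bsub>scalars K\<^esub> y = x + y" "x \<otimes>\<^bsub>scalars K\<^esub> y = x * y" "c \<odot>\<^bsub>scalars K\<^esub> x = c * x"
  "\<parallel>x\<parallel>\<^bsub>scalars K\<^esub> = cmod x"
  by (simp_all add: scalars_def)

lemma linear_op_comp:
  assumes f: "linear_op K V W f" and g: "linear_op K W U g"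
  shows "linear_op K V U (g \<circ> f)"
proof -
  have "f x \<in> carrier W" if "x \<in> carrier V" for x
    using f that by (auto simp: linear_op_def)
  then show ?thesis using f g unfolding linear_op_def by auto
qed

context banach_space
begin

lemma vdist_zero_right:
  assumes "x \<in> carrier V"
  shows "vdist V x \<zero> = \<parallel>x\<parallel>"
proof -
  have "x \<ominus> \<zero> = x \<oplus> \<ominus> \<zero>" using assms by (simp add: M.minus_eq)
  also have "\<ominus> \<zero> = \<zero>" by (rule M.minus_equality) simp_all
  also have "x \<oplus> \<zero> = x" using assms by simp
  finally show ?thesis using assms by (simp add: vdist_def)
qed

lemma vnorm_nonneg: "x \<in> carrier V \<Longrightarrow> 0 \<le> \<parallel>x\<parallel>"
  using Metric_space.nonneg[OF Metric_space_vdist, of x \<zero>] by (simp add: vdist_zero_right)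

lemma vnorm_zero [simp]: "\<parallel>\<zero>\<parallel> = 0"
  using vnorm_eq_0[of \<zero>] by simp

lemma smult_in_carrier [simp]: "c \<in> K \<Longrightarrow> x \<in> carrier V \<Longrightarrow> c \<odot> x \<in> carrier V"
  using smult_closed by simp

lemma zero_scalar [simp]: "0 \<in> K"
  using R.zero_closed by simp

lemma smult_zero_scalar [simp]: "x \<in> carrier V \<Longrightarrow> 0 \<odot> x = \<zero>"
  using smult_l_null by simp

lemma linear_op_zero:
  assumes "linear_op K V W f" "banach_space K W"
  shows "f \<zero> = \<zero>\<^bsub>W\<^esub>"
proof -
  interpret W: banach_space K W by fact
  have "f \<zero> \<in> carrier W" using assms(1) by (auto simp: linear_op_def)
  have "f (0 \<odot> \<zero>) = 0 \<odot>\<^bsub>W\<^esub> f \<zero>"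
    using assms(1) zero_scalar M.zero_closed unfolding linear_op_def by blast
  then show ?thesis using \<open>f \<zero> \<in> carrier W\<close> by simp
qed

lemma bounded_ops_bound:
  assumes K: "range complex_of_real \<subseteq> K" and W: "banach_space K W"
    and f: "f \<in> bounded_ops K V W"
  obtains C where "\<And>x. x \<in> carrier V \<Longrightarrow> \<parallel>f x\<parallel>\<^bsub>W\<^esub> \<le> C * \<parallel>x\<parallel>"
proof -
  interpret W: banach_space K W by fact
  have lin: "linear_op K V W f" and cont: "continuous_map (vtopology V) (vtopology W) f"
    using f by (auto simp: bounded_ops_def)
  have fW: "f x \<in> carrier W" if "x \<in> carrier V" for x
    using lin that by (auto simp: linear_op_def)
  have f0: "f \<zero> = \<zero>\<^bsub>W\<^esub>" by (rule linear_op_zero[OF lin W])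
  interpret MV: Metric_space "carrier V" "vdist V" by (rule Metric_space_vdist)
  interpret MW: Metric_space "carrier W" "vdist W" by (rule W.Metric_space_vdist)
  obtain d where d: "d > 0" "\<And>x. x \<in> carrier V \<Longrightarrow> vdist V \<zero> x < d \<Longrightarrow> vdist W (f \<zero>) (f x) < 1"
    using cont unfolding vtopology_def MV.metric_continuous_map[OF W.Metric_space_vdist]
    by (meson M.zero_closed zero_less_one)
  have near: "\<parallel>f x\<parallel>\<^bsub>W\<^esub> < 1" if "x \<in> carrier V" "\<parallel>x\<parallel> < d" for x
    using d(2)[of x] that fW[of x] vdist_zero_right[of x] W.vdist_zero_right[of "f x"]
    by (simp add: f0 MV.commute[of \<zero>] MW.commute[of "\<zero>\<^bsub>W\<^esub>"])
  have "\<parallel>f x\<parallel>\<^bsub>W\<^esub> \<le> 2 / d * \<parallel>x\<parallel>" if x: "x \<in> carrier V" for x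
  proof (cases "x = \<zero>")
    case True
    then show ?thesis by (simp add: f0)
  next
    case False
    then have pos: "\<parallel>x\<parallel> > 0"
      using vnorm_eq_0[OF x] vnorm_nonneg[OF x] by simp
    define c where "c = d / 2 / \<parallel>x\<parallel>"
    have "c > 0" using pos d(1) by (simp add: c_def)
    then have c: "c > 0" "complex_of_real c \<in> K" using K by auto
    have "\<parallel>complex_of_real c \<odot> x\<parallel> = c * \<parallel>x\<parallel>"
      using vnorm_smult[OF c(2) x] c(1) by simp
    also have "\<dots> < d" using pos d(1) by (simp add: c_def)
    finally have "\<parallel>f (complex_of_real c \<odot> x)\<parallel>\<^bsub>W\<^esub> < 1"
      using near[of "complex_of_real c \<odot> x"] x c by simp
    moreover have "f (complex_of_real c \<odot> x) = complex_of_real c \<odot>\<^bsub>W\<^esub> f x"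
      using lin c(2) x by (simp add: linear_op_def)
    ultimately have "c * \<parallel>f x\<parallel>\<^bsub>W\<^esub> < 1"
      using W.vnorm_smult[OF c(2) fW[OF x]] c(1) by simp
    then show ?thesis using pos d(1) by (simp add: c_def field_simps)
  qed
  then show thesis by (rule that)
qed

text \<open>
  As \<open>op_norm\<close> is a supremum of reals, the bound by \<open>1\<close> carries information only because
  continuity makes the set of values bounded.
\<close>

lemma dual_ball_bound:
  assumes K: "K = \<real> \<or> K = UNIV" and \<phi>: "\<phi> \<in> dual_ball K V" and x: "x \<in> carrier V"
  shows "cmod (\<phi> x) \<le> \<parallel>x\<parallel>"
proof -
  have KR: "range complex_of_real \<subseteq> K" using K by (auto simp: Reals_def)
  have Kb: "banach_space K (scalars K)" by (rule banach_space_scalars[OF K])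
  have b: "\<phi> \<in> bounded_ops K V (scalars K)" and n: "op_norm V (scalars K) \<phi> \<le> 1"
    using \<phi> by (auto simp: dual_ball_def)
  then have lin: "linear_op K V (scalars K) \<phi>" by (simp add: bounded_ops_def)
  obtain C where C: "\<And>x. x \<in> carrier V \<Longrightarrow> cmod (\<phi> x) \<le> C * \<parallel>x\<parallel>"
    using bounded_ops_bound[OF KR Kb b] by auto
  have "cmod (\<phi> x) \<le> \<bar>C\<bar>" if "x \<in> carrier V" "\<parallel>x\<parallel> \<le> 1" for x
  proof -
    have "C * \<parallel>x\<parallel> \<le> \<bar>C\<bar> * 1"
      using that vnorm_nonneg by (intro mult_mono) auto
    then show ?thesis using C[OF that(1)] by simp
  qed
  then have bdd: "bdd_above ((\<lambda>x. cmod (\<phi> x)) ` {x \<in> carrier V. \<parallel>x\<parallel> \<le> 1})"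
    by (intro bdd_aboveI2[of _ _ "\<bar>C\<bar>"]) auto
  have unit: "cmod (\<phi> y) \<le> 1" if "y \<in> carrier V" "\<parallel>y\<parallel> \<le> 1" for y
  proof -
    have "cmod (\<phi> y) \<le> (SUP x\<in>{x \<in> carrier V. \<parallel>x\<parallel> \<le> 1}. cmod (\<phi> x))"
      using that by (intro cSUP_upper bdd) auto
    then show ?thesis using n by (simp add: op_norm_def)
  qed
  show ?thesis
  proof (cases "x = \<zero>")
    case True
    then show ?thesis using linear_op_zero[OF lin Kb] by simp
  next
    case False
    then have pos: "\<parallel>x\<parallel> > 0"
      using vnorm_eq_0[OF x] vnorm_nonneg[OF x] by simp
    define c where "c = complex_of_real (1 / \<parallel>x\<parallel>)"
    have c: "c \<in> K" "cmod c = 1 / \<parallel>x\<parallel>" using KR pos by (auto simp: c_def norm_divide simp del: of_real_divide)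
    have "cmod (\<phi> (c \<odot> x)) \<le> 1"
      using unit[of "c \<odot> x"] x c vnorm_smult[OF c(1) x] pos by simp
    moreover have "\<phi> (c \<odot> x) = c * \<phi> x"
      using lin c(1) x by (simp add: linear_op_def)
    ultimately show ?thesis using pos c(2) by (simp add: norm_mult)
  qed
qed

lemma linear_op_combination:
  assumes lin: "linear_op K V (scalars K) \<phi>" and K: "banach_space K (scalars K)"
    and "finite J" and "\<And>j. j \<in> J \<Longrightarrow> c j \<in> K" and "\<And>j. j \<in> J \<Longrightarrow> x j \<in> carrier V"
  shows "\<phi> (\<Oplus>j\<in>J. c j \<odot> x j) = (\<Sum>j\<in>J. c j * \<phi> (x j))"
  using assms(3-5)
proof (induction J)
  case empty
  then show ?case using linear_op_zero[OF lin K] by simp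
next
  case (insert i J)
  have "(\<Oplus>j\<in>J. c j \<odot> x j) \<in> carrier V"
    using insert by (intro M.finsum_closed) auto
  moreover have "(\<Oplus>j\<in>insert i J. c j \<odot> x j) = c i \<odot> x i \<oplus> (\<Oplus>j\<in>J. c j \<odot> x j)"
    using insert by (intro M.finsum_insert) auto
  ultimately have "\<phi> (\<Oplus>j\<in>insert i J. c j \<odot> x j)
      = \<phi> (c i \<odot> x i) + \<phi> (\<Oplus>j\<in>J. c j \<odot> x j)"
    using lin insert.prems by (simp add: linear_op_def)
  also have "\<phi> (c i \<odot> x i) = c i * \<phi> (x i)"
    using lin insert.prems by (simp add: linear_op_def)
  finally show ?case using insert by simp
qed

text \<open>
  Multiplying a vector by \<open>t\<^bsup>1/p\<^esup>\<close> brings a weight \<open>t\<close> into sums of \<open>p\<close>-th powers. This turns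
  summing inequalities into weighted ones.
\<close>

lemma linear_op_scaled_powr:
  assumes f: "linear_op K V W f" and W: "banach_space K W"
    and t: "t \<ge> 0" "complex_of_real (t powr (1 / p)) \<in> K" and "p > 0" and x: "x \<in> carrier V"
  shows "\<parallel>f (complex_of_real (t powr (1 / p)) \<odot> x)\<parallel>\<^bsub>W\<^esub> powr p = t * \<parallel>f x\<parallel>\<^bsub>W\<^esub> powr p"
proof -
  interpret W: banach_space K W by fact
  have fx: "f x \<in> carrier W" using f x by (auto simp: linear_op_def)
  have "f (complex_of_real (t powr (1 / p)) \<odot> x) = complex_of_real (t powr (1 / p)) \<odot>\<^bsub>W\<^esub> f x"
    using f t(2) x by (simp add: linear_op_def)
  then show ?thesis
    using t \<open>p > 0\<close> W.vnorm_smult[OF t(2) fx] W.vnorm_nonneg[OF fx]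
    by (simp add: powr_mult powr_powr)
qed

end

section \<open>Summing operators in terms of finite families\<close>

text \<open>
  The bound \<open>B\<close> is positive so that a family can be normalized by dividing by it.
\<close>

definition finitely_summing ::
    "complex set \<Rightarrow> real \<Rightarrow> 'a normed_module \<Rightarrow> 'b normed_module \<Rightarrow> ('a \<Rightarrow> 'b) \<Rightarrow> real \<Rightarrow> bool" where
  "finitely_summing K p V W u C \<longleftrightarrow>
     (\<forall>(I :: nat set) x B. finite I \<longrightarrow> (\<forall>i\<in>I. x i \<in> carrier V) \<longrightarrow> B > 0 \<longrightarrow>
        (\<forall>\<phi>\<in>dual_ball K V. (\<Sum>i\<in>I. cmod (\<phi> (x i)) powr p) \<le> B) \<longrightarrow>
        (\<Sum>i\<in>I. \<parallel>u (x i)\<parallel>\<^bsub>W\<^esub> powr p) \<le> C * B)"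

lemma finitely_summingD:
  fixes I :: "nat set"
  assumes "finitely_summing K p V W u C" "finite I" "\<And>i. i \<in> I \<Longrightarrow> x i \<in> carrier V" "B > 0"
    and "\<And>\<phi>. \<phi> \<in> dual_ball K V \<Longrightarrow> (\<Sum>i\<in>I. cmod (\<phi> (x i)) powr p) \<le> B"
  shows "(\<Sum>i\<in>I. \<parallel>u (x i)\<parallel>\<^bsub>W\<^esub> powr p) \<le> C * B"
  using assms unfolding finitely_summing_def by blast

text \<open>
  Otherwise there is, for every \<open>N\<close>, a finite family whose image has \<open>p\<close>-sum above \<open>1\<close> although
  its weak \<open>p\<close>-sum is at most \<open>2\<^bsup>-N\<^esup>\<close>. Placed in the rows of a double sequence, these families form
  a weakly \<open>p\<close>-summable sequence whose image is not \<open>p\<close>-summable.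
\<close>

lemma summing_ops_finitely_summing:
  assumes K: "K = \<real> \<or> K = UNIV" and "p > 0"
    and V: "banach_space K V" and W: "banach_space K W"
    and u: "u \<in> summing_ops K p V W"
  obtains C where "C > 0" "finitely_summing K p V W u C"
proof -
  interpret V: banach_space K V by fact
  interpret W: banach_space K W by fact
  have KR: "complex_of_real t \<in> K" for t using K by auto
  have lin: "linear_op K V W u"
    and sums: "\<And>x. x \<in> weak_lp_seqs K p V \<Longrightarrow> (\<lambda>j. u (x j)) \<in> lp_seqs p W"
    using u by (auto simp: summing_ops_def bounded_ops_def)
  have "\<exists>N. finitely_summing K p V W u (2 ^ N)"
  proof (rule ccontr)
    assume none: "\<nexists>N. finitely_summing K p V W u (2 ^ N)"
    define Q where "Q N I x B \<longleftrightarrow> finite I \<and> (\<forall>i\<in>I. x i \<in> carrier V) \<and> B > 0 \<and>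
      (\<forall>\<phi>\<in>dual_ball K V. (\<Sum>i\<in>I. cmod (\<phi> (x i)) powr p) \<le> B) \<and>
      (\<Sum>i\<in>I. \<parallel>u (x i)\<parallel>\<^bsub>W\<^esub> powr p) > 2 ^ N * B" for N and I :: "nat set" and x and B :: real
    have "\<exists>I x B. Q N I x B" for N
      using none unfolding finitely_summing_def Q_def not_ex not_all not_imp not_le by simp
    then obtain I x B where Q: "\<And>N. Q N (I N) (x N) (B N)" by metis
    then have bad:
        "\<And>N. finite (I N)" "\<And>N i. i \<in> I N \<Longrightarrow> x N i \<in> carrier V" "\<And>N. B N > 0"
        "\<And>N \<phi>. \<phi> \<in> dual_ball K V \<Longrightarrow> (\<Sum>i\<in>I N. cmod (\<phi> (x N i)) powr p) \<le> B N"
        "\<And>N. (\<Sum>i\<in>I N. \<parallel>u (x N i)\<parallel>\<^bsub>W\<^esub> powr p) > 2 ^ N * B N"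
      unfolding Q_def by blast+
    (* As a weight on p-th powers, s N brings the weak p-sum from B N down to 2 ^ (- N). *)
    define s where "s N = 1 / (2 ^ N * B N)" for N
    have s: "s N > 0" for N using bad(3)[of N] by (simp add: s_def)
    define g where "g N i = (if i \<in> I N then complex_of_real (s N powr (1 / p)) \<odot>\<^bsub>V\<^esub> x N i else \<zero>\<^bsub>V\<^esub>)" for N i
    have gV: "g N i \<in> carrier V" for N i
      using bad(2) KR by (simp add: g_def)
    have g_functional: "cmod (\<phi> (g N i)) powr p = (if i \<in> I N then s N * cmod (\<phi> (x N i)) powr p else 0)"
      if "\<phi> \<in> dual_ball K V" for \<phi> N i
    proof -
      have l: "linear_op K V (scalars K) \<phi>"
        using that by (simp add: dual_ball_def bounded_ops_def)
      have "\<phi> \<zero>\<^bsub>V\<^esub> = 0" using V.linear_op_zero[OF l banach_space_scalars[OF K]] by simp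
      then show ?thesis
        using V.linear_op_scaled_powr[OF l banach_space_scalars[OF K] _ KR \<open>p > 0\<close> bad(2)] s[of N]
        by (auto simp: g_def)
    qed
    have g_image: "\<parallel>u (g N i)\<parallel>\<^bsub>W\<^esub> powr p = s N * \<parallel>u (x N i)\<parallel>\<^bsub>W\<^esub> powr p" if "i \<in> I N" for N i
      using V.linear_op_scaled_powr[OF lin W _ KR \<open>p > 0\<close> bad(2)[OF that]] s[of N] that
      by (simp add: g_def)
    define y where "y j = (case prod_decode j of (N, i) \<Rightarrow> g N i)" for j
    have "(\<lambda>j. u (y j)) \<in> lp_seqs p W"
    proof (rule sums)
      have "(\<Sum>j. ennreal (cmod (\<phi> (y j)) powr p)) \<le> 2" if \<phi>: "\<phi> \<in> dual_ball K V" for \<phi>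
      proof -
        define F where "F = (\<lambda>(N, i). ennreal (cmod (\<phi> (g N i)) powr p))"
        have row: "(\<Sum>i. F (N, i)) \<le> ennreal ((1 / 2) ^ N)" for N
        proof -
          have "(\<Sum>i. F (N, i)) = (\<Sum>i\<in>I N. F (N, i))"
            using bad(1) g_functional[OF \<phi>] by (intro suminf_finite) (auto simp: F_def)
          also have "\<dots> = ennreal (\<Sum>i\<in>I N. cmod (\<phi> (g N i)) powr p)"
            by (simp add: F_def sum_ennreal)
          also have "(\<Sum>i\<in>I N. cmod (\<phi> (g N i)) powr p) = s N * (\<Sum>i\<in>I N. cmod (\<phi> (x N i)) powr p)"
            by (simp add: g_functional[OF \<phi>] sum_distrib_left)
          also have "\<dots> \<le> s N * B N"
            using s[of N] by (intro mult_left_mono bad(4)[OF \<phi>]) simp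
          also have "\<dots> = (1 / 2) ^ N"
            using bad(3)[of N] by (simp add: s_def power_divide)
          finally show ?thesis by (simp add: ennreal_leI)
        qed
        have "(\<Sum>j. ennreal (cmod (\<phi> (y j)) powr p)) = (\<Sum>j. F (prod_decode j))"
          by (simp add: F_def y_def split_beta)
        also have "\<dots> = (\<Sum>N. \<Sum>i. F (N, i))"
          by (rule suminf_ennreal_2dimen) (rule refl)
        also have "\<dots> \<le> (\<Sum>N. ennreal ((1 / 2) ^ N))"
          by (intro suminf_le row) auto
        also have "\<dots> = ennreal (\<Sum>N. (1 / 2) ^ N)"
          by (intro suminf_ennreal2) (auto intro: summable_geometric)
        also have "\<dots> = 2" by (simp add: suminf_geometric)
        finally show ?thesis .
      qed
      then have "(SUP \<phi>\<in>dual_ball K V. \<Sum>j. ennreal (cmod (\<phi> (y j)) powr p)) \<le> 2"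
        by (rule SUP_least)
      also have "(2 :: ennreal) < \<infinity>" by simp
      finally show "y \<in> weak_lp_seqs K p V"
        by (auto simp: weak_lp_seqs_def y_def gV split: prod.split)
    qed
    then have summ: "summable (\<lambda>j. \<parallel>u (y j)\<parallel>\<^bsub>W\<^esub> powr p)"
      by (simp add: lp_seqs_def)
    have "real m \<le> (\<Sum>j. \<parallel>u (y j)\<parallel>\<^bsub>W\<^esub> powr p)" for m
    proof -
      define J where "J = prod_encode ` (SIGMA N:{..<m}. I N)"
      have "real m = (\<Sum>N<m. 1)" by simp
      also have "\<dots> \<le> (\<Sum>N<m. \<Sum>i\<in>I N. \<parallel>u (g N i)\<parallel>\<^bsub>W\<^esub> powr p)"
      proof (rule sum_mono)
        fix N
        have "1 = s N * (2 ^ N * B N)" using bad(3)[of N] by (simp add: s_def)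
        also have "\<dots> \<le> s N * (\<Sum>i\<in>I N. \<parallel>u (x N i)\<parallel>\<^bsub>W\<^esub> powr p)"
          using bad(5)[of N] s[of N] by (intro mult_left_mono) auto
        also have "\<dots> = (\<Sum>i\<in>I N. \<parallel>u (g N i)\<parallel>\<^bsub>W\<^esub> powr p)"
          by (simp add: g_image sum_distrib_left)
        finally show "1 \<le> (\<Sum>i\<in>I N. \<parallel>u (g N i)\<parallel>\<^bsub>W\<^esub> powr p)" .
      qed
      also have "\<dots> = (\<Sum>(N, i)\<in>(SIGMA N:{..<m}. I N). \<parallel>u (g N i)\<parallel>\<^bsub>W\<^esub> powr p)"
        by (intro sum.Sigma) (auto simp: bad(1))
      also have "\<dots> = (\<Sum>j\<in>J. \<parallel>u (y j)\<parallel>\<^bsub>W\<^esub> powr p)"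
        unfolding J_def by (subst sum.reindex) (auto simp: y_def inj_prod_encode intro!: sum.cong)
      also have "\<dots> \<le> (\<Sum>j. \<parallel>u (y j)\<parallel>\<^bsub>W\<^esub> powr p)"
        by (intro sum_le_suminf summ) (auto simp: J_def bad(1))
      finally show ?thesis .
    qed
    then show False using reals_Archimedean2 by (meson not_le)
  qed
  then obtain N where "finitely_summing K p V W u (2 ^ N)" ..
  then show thesis by (intro that[of "2 ^ N"]) simp_all
qed

lemma finitely_summing_imp_summing:
  assumes "u \<in> bounded_ops K V W" and fs: "finitely_summing K r V W u C"
  shows "u \<in> summing_ops K r V W"
proof -
  have "(\<lambda>j. u (x j)) \<in> lp_seqs r W" if x: "x \<in> weak_lp_seqs K r V" for x
  proof -
    have xV: "x j \<in> carrier V" for j using x by (simp add: weak_lp_seqs_def)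
    define s where "s = (SUP \<phi>\<in>dual_ball K V. \<Sum>j. ennreal (cmod (\<phi> (x j)) powr r))"
    have s: "s < \<infinity>" using x by (simp add: weak_lp_seqs_def s_def)
    define M where "M = enn2real s + 1"
    have M: "M > 0" by (simp add: M_def add_nonneg_pos)
    have weak: "(\<Sum>j<m. cmod (\<phi> (x j)) powr r) \<le> M" if "\<phi> \<in> dual_ball K V" for \<phi> m
    proof -
      have "ennreal (\<Sum>j<m. cmod (\<phi> (x j)) powr r) = (\<Sum>j<m. ennreal (cmod (\<phi> (x j)) powr r))"
        by (simp add: sum_ennreal)
      also have "\<dots> \<le> (\<Sum>j. ennreal (cmod (\<phi> (x j)) powr r))"
        by (intro sum_le_suminf) auto
      also have "\<dots> \<le> s" unfolding s_def by (intro SUP_upper that)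
      also have "s = ennreal (enn2real s)" using s by simp
      also have "\<dots> \<le> ennreal M" by (intro ennreal_leI) (simp add: M_def)
      finally show ?thesis using M by (simp add: ennreal_le_iff)
    qed
    have "(\<Sum>j<m. \<parallel>u (x j)\<parallel>\<^bsub>W\<^esub> powr r) \<le> C * M" for m
      by (rule finitely_summingD[where x = x and I = "{..<m}", OF fs _ xV M weak]) simp
    then have "summable (\<lambda>j. \<parallel>u (x j)\<parallel>\<^bsub>W\<^esub> powr r)"
      by (intro summableI_nonneg_bounded) auto
    moreover have "u (x j) \<in> carrier W" for j
      using assms(1) xV by (auto simp: bounded_ops_def linear_op_def)
    ultimately show ?thesis by (simp add: lp_seqs_def)
  qed
  then show ?thesis using assms(1) by (simp add: summing_ops_def)
qed

section \<open>Domination by an average of functionals\<close>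

text \<open>
  This is \<open>averages_approach\<close> for the target \<open>\<parallel>u y\<^sub>j\<parallel>\<^sup>q / 2C\<close>: the summing inequality for the
  weighted family provides a functional in response to each weighting. One factor \<open>2\<close>
  provides a strict inequality, since the supremum over the dual ball need not be attained; the
  other one absorbs the error \<open>\<epsilon>\<close>, which is possible because no \<open>u y\<^sub>j\<close> vanishes.
\<close>

lemma finite_Pietsch_domination:
  fixes J :: "nat set"
  assumes K: "K = \<real> \<or> K = UNIV" and "q > 0" and "C > 0"
    and V: "banach_space K V" and W: "banach_space K W"
    and lin: "linear_op K V W u" and fs: "finitely_summing K q V W u C"
    and J: "finite J" "J \<noteq> {}" and y: "\<And>j. j \<in> J \<Longrightarrow> y j \<in> carrier V" "\<And>j. j \<in> J \<Longrightarrow> \<parallel>u (y j)\<parallel>\<^bsub>W\<^esub> > 0"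
  shows "\<exists>n>0. \<exists>\<psi>. (\<forall>k<n. \<psi> k \<in> dual_ball K V) \<and>
    (\<forall>j\<in>J. \<parallel>u (y j)\<parallel>\<^bsub>W\<^esub> powr q \<le> 4 * C * ((\<Sum>k<n. cmod (\<psi> k (y j)) powr q) / real n))"
proof -
  interpret V: banach_space K V by fact
  have KR: "complex_of_real t \<in> K" for t using K by auto
  define a where "a j = \<parallel>u (y j)\<parallel>\<^bsub>W\<^esub> powr q / (2 * C)" for j
  have a_pos: "a j > 0" if "j \<in> J" for j
    using y(2)[OF that] \<open>C > 0\<close> by (simp add: a_def)
  define \<epsilon> where "\<epsilon> = Min (a ` J) / 2"
  have \<epsilon>: "\<epsilon> > 0" "\<And>j. j \<in> J \<Longrightarrow> \<epsilon> \<le> a j / 2"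
    using J a_pos by (auto simp: \<epsilon>_def)
  have "\<exists>n>0. \<exists>\<psi>. (\<forall>k<n. \<psi> k \<in> dual_ball K V) \<and>
      (\<forall>j\<in>J. a j - \<epsilon> \<le> (\<Sum>k<n. cmod (\<psi> k (y j)) powr q) / real n)"
  proof (rule averages_approach[OF J _ _ \<epsilon>(1)])
    fix \<psi> j assume \<psi>: "\<psi> \<in> dual_ball K V" and "j \<in> J"
    have "\<parallel>y j\<parallel>\<^bsub>V\<^esub> powr q \<le> (\<Sum>j\<in>J. \<parallel>y j\<parallel>\<^bsub>V\<^esub> powr q)"
      using J \<open>j \<in> J\<close> by (intro member_le_sum) auto
    moreover have "cmod (\<psi> (y j)) powr q \<le> \<parallel>y j\<parallel>\<^bsub>V\<^esub> powr q"
      using V.dual_ball_bound[OF K \<psi> y(1)[OF \<open>j \<in> J\<close>]] \<open>q > 0\<close> by (intro powr_mono2) auto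
    ultimately show "\<bar>cmod (\<psi> (y j)) powr q\<bar> \<le> (\<Sum>j\<in>J. \<parallel>y j\<parallel>\<^bsub>V\<^esub> powr q)" by simp
  next
    fix w :: "nat \<Rightarrow> real" assume w: "\<And>i. i \<in> J \<Longrightarrow> 0 \<le> w i" "\<exists>i\<in>J. 0 < w i"
    show "\<exists>\<psi>\<in>dual_ball K V. (\<Sum>j\<in>J. w j * a j) \<le> (\<Sum>j\<in>J. w j * cmod (\<psi> (y j)) powr q)"
    proof (rule ccontr)
      assume none: "\<not> ?thesis"
      define B where "B = (\<Sum>j\<in>J. w j * a j)"
      obtain i where "i \<in> J" "w i > 0" using w(2) by blast
      then have "B > 0"
        unfolding B_def using w(1) a_pos J by (intro sum_pos2[of J i]) (auto simp: less_imp_le)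
      let ?x = "\<lambda>j. complex_of_real (w j powr (1 / q)) \<odot>\<^bsub>V\<^esub> y j"
      have "(\<Sum>j\<in>J. \<parallel>u (?x j)\<parallel>\<^bsub>W\<^esub> powr q) \<le> C * B"
      proof (rule finitely_summingD[OF fs J(1) _ \<open>B > 0\<close>])
        fix \<psi> assume \<psi>: "\<psi> \<in> dual_ball K V"
        then have l: "linear_op K V (scalars K) \<psi>"
          by (simp add: dual_ball_def bounded_ops_def)
        have "(\<Sum>j\<in>J. cmod (\<psi> (?x j)) powr q) = (\<Sum>j\<in>J. w j * cmod (\<psi> (y j)) powr q)"
          using V.linear_op_scaled_powr[OF l banach_space_scalars[OF K] w(1) KR \<open>q > 0\<close> y(1)]
          by (intro sum.cong) simp_all
        also have "\<dots> \<le> B" using none \<psi> by (auto simp: B_def not_le intro: less_imp_le)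
        finally show "(\<Sum>j\<in>J. cmod (\<psi> (?x j)) powr q) \<le> B" .
      qed (use y KR in simp)
      also have "(\<Sum>j\<in>J. \<parallel>u (?x j)\<parallel>\<^bsub>W\<^esub> powr q) = (\<Sum>j\<in>J. w j * \<parallel>u (y j)\<parallel>\<^bsub>W\<^esub> powr q)"
        using V.linear_op_scaled_powr[OF lin W w(1) KR \<open>q > 0\<close> y(1)] by (intro sum.cong) simp_all
      also have "\<dots> = 2 * C * B"
        using \<open>C > 0\<close> by (simp add: B_def a_def sum_distrib_left)
      finally show False using \<open>B > 0\<close> \<open>C > 0\<close> by simp
    qed
  qed
  then obtain n \<psi> where n: "n > 0" "\<And>k. k < n \<Longrightarrow> \<psi> k \<in> dual_ball K V"
    "\<And>j. j \<in> J \<Longrightarrow> a j - \<epsilon> \<le> (\<Sum>k<n. cmod (\<psi> k (y j)) powr q) / real n" by blast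
  have "\<parallel>u (y j)\<parallel>\<^bsub>W\<^esub> powr q \<le> 4 * C * ((\<Sum>k<n. cmod (\<psi> k (y j)) powr q) / real n)" if "j \<in> J" for j
  proof -
    have "a j / 2 \<le> (\<Sum>k<n. cmod (\<psi> k (y j)) powr q) / real n"
      using n(3)[OF that] \<epsilon>(2)[OF that] by linarith
    then have "4 * C * (a j / 2) \<le> 4 * C * ((\<Sum>k<n. cmod (\<psi> k (y j)) powr q) / real n)"
      using \<open>C > 0\<close> by (intro mult_left_mono) auto
    then show ?thesis using \<open>C > 0\<close> by (simp add: a_def)
  qed
  then show ?thesis using n(1,2) by blast
qed

section \<open>The composition theorem\<close>

text \<open>
  Write \<open>A\<^sub>k = \<psi>\<^sub>k (v z\<^sub>k)\<close> for the test vectors \<open>z\<^sub>k\<close>, so that \<open>S\<close> is the average of the \<open>A\<^sub>k\<close>.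
  Hoelder's inequality bounds \<open>|\<phi> z\<^sub>k|\<^sup>p\<close>, up to the factor \<open>A\<^sub>k\<^bsup>p(1 - 1/r)\<^esup>\<close>, by a sum in which
  \<open>|\<phi> x\<^sub>j|\<^sup>r\<close> has the coefficient \<open>(|\<psi>\<^sub>k y\<^sub>j| / \<sigma>\<^sub>j)\<^sup>q / \<sigma>\<^sub>j\<^sup>p\<close>. The choice of \<open>\<sigma>\<close> makes the
  average over \<open>k\<close> of these coefficients equal to \<open>1\<close>. Hence the \<open>z\<^sub>k\<close>, with weights proportional
  to \<open>A\<^sub>k\<^bsup>-p(1 - 1/r)\<^esup>\<close>, have weak \<open>p\<close>-sum at most \<open>M\<^bsup>p/r\<^esup>\<close>, and the \<open>p\<close>-summing inequality of
  \<open>v\<close> applies. A second use of Hoelder's inequality removes the weights from \<open>A\<^sub>k \<le> \<parallel>v z\<^sub>k\<parallel>\<close>.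
\<close>

lemma finite_factorization_estimate:
  fixes J :: "nat set" and n :: nat and p q r C M :: real
  assumes K: "K = \<real> \<or> K = UNIV"
    and p: "p > 1" and q: "q > 1" and r: "r \<ge> 1" and pqr: "1 / r = 1 / p + 1 / q"
    and W: "banach_space K W" and Y: "banach_space K Y"
    and lin: "linear_op K W Y v" and fs: "finitely_summing K p W Y v C" and "C > 0"
    and J: "finite J" and x: "\<And>j. j \<in> J \<Longrightarrow> x j \<in> carrier W" and "M > 0"
    and weak: "\<And>\<phi>. \<phi> \<in> dual_ball K W \<Longrightarrow> (\<Sum>j\<in>J. cmod (\<phi> (x j)) powr r) \<le> M"
    and n: "n > 0" and \<psi>: "\<And>k. k < n \<Longrightarrow> \<psi> k \<in> dual_ball K Y"
    and b: "\<And>j. b j = (\<Sum>k<n. cmod (\<psi> k (v (x j))) powr q) / real n" "\<And>j. j \<in> J \<Longrightarrow> b j > 0"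
  shows "(\<Sum>j\<in>J. b j powr (r / q)) \<le> C powr (r / p) * M"
proof (cases "J = {}")
  case True
  then show ?thesis using \<open>M > 0\<close> by simp
next
  case False
  interpret W: banach_space K W by fact
  interpret Y: banach_space K Y by fact
  have KR: "complex_of_real t \<in> K" for t using K by auto
  have vY: "v w \<in> carrier Y" if "w \<in> carrier W" for w
    using lin that by (auto simp: linear_op_def)
  have \<psi>_lin: "linear_op K Y (scalars K) (\<psi> k)" if "k < n" for k
    using \<psi>[OF that] by (simp add: dual_ball_def bounded_ops_def)
  have "1 / r = (p + q) / (p * q)" unfolding pqr using p q by (simp add: field_simps)
  then have rpq: "(p + q) * r = p * q" using p q r by (simp add: frac_eq_eq)
  have "r / p + r / q = r * (1 / r)" unfolding pqr by (simp add: distrib_left)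
  then have rp: "r / p + r / q = 1" using r by simp
  (* This exponent makes sigma ^ p * sigma ^ q equal to b, and sigma ^ p the summand of S. *)
  define \<sigma> where "\<sigma> j = b j powr (1 / (p + q))" for j
  have \<sigma>: "\<sigma> j > 0" "\<sigma> j powr (p + q) = b j" "\<sigma> j powr p = b j powr (r / q)" if "j \<in> J" for j
  proof -
    show "\<sigma> j > 0" "\<sigma> j powr (p + q) = b j"
      using b(2)[OF that] p q by (simp_all add: \<sigma>_def powr_powr)
    have "p / (p + q) = r / q" using rpq p q by (simp add: frac_eq_eq mult.commute)
    then show "\<sigma> j powr p = b j powr (r / q)" by (simp add: \<sigma>_def powr_powr)
  qed
  define S where "S = (\<Sum>j\<in>J. \<sigma> j powr p)"
  have "S > 0" unfolding S_def using J False \<sigma>(1) by (intro sum_pos) (auto simp: less_imp_neq[symmetric])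
  define g where "g k j = cmod (\<psi> k (v (x j))) / \<sigma> j" for k j
  have g0: "g k j \<ge> 0" if "j \<in> J" for k j using \<sigma>(1)[OF that] by (simp add: g_def)
  have g_avg: "(\<Sum>k<n. g k j powr q) = real n * \<sigma> j powr p" if "j \<in> J" for j
  proof -
    have "(\<Sum>k<n. g k j powr q) = (\<Sum>k<n. cmod (\<psi> k (v (x j))) powr q) / \<sigma> j powr q"
      unfolding g_def using \<sigma>(1)[OF that] by (simp add: powr_divide sum_divide_distrib)
    also have "\<dots> = real n * b j / \<sigma> j powr q" using n by (simp add: b(1))
    also have "b j = \<sigma> j powr p * \<sigma> j powr q" using \<sigma>(2)[OF that] by (simp add: powr_add)
    finally show ?thesis using \<sigma>(1)[OF that] by simp
  qed
  define A where "A k = (\<Sum>j\<in>J. g k j powr q)" for k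
  have A0: "A k \<ge> 0" for k by (simp add: A_def sum_nonneg)
  have A_avg: "(\<Sum>k<n. A k / real n) = S"
  proof -
    have "(\<Sum>k<n. A k / real n) = (\<Sum>j\<in>J. \<Sum>k<n. g k j powr q) / real n"
      unfolding A_def sum_divide_distrib[symmetric] by (subst sum.swap) (rule refl)
    also have "\<dots> = S" using n by (simp add: g_avg S_def sum_distrib_left[symmetric])
    finally show ?thesis .
  qed
  (* With these coefficients, c k j * psi k (v (x j)) = g k j powr q: the equality case of
     Hoelder's inequality for the conjugate exponents q and q / (q - 1). *)
  define c where "c k j = complex_of_real (g k j powr (q - 1) / \<sigma> j) * cnj (sgn (\<psi> k (v (x j))))" for k j
  have cK: "c k j \<in> K" if "k < n" "j \<in> J" for k j
  proof -
    have "\<psi> k (v (x j)) \<in> K"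
      using \<psi>_lin[OF that(1)] vY[OF x[OF that(2)]] by (auto simp: linear_op_def)
    then show ?thesis
      using K by (auto simp: c_def sgn_eq Reals_mult Reals_cnj_iff complex_is_Real_iff)
  qed
  define z where "z k = (\<Oplus>\<^bsub>W\<^esub>j\<in>J. c k j \<odot>\<^bsub>W\<^esub> x j)" for k
  have zW: "z k \<in> carrier W" if "k < n" for k
    unfolding z_def using cK[OF that] x by (intro W.M.finsum_closed) auto
  have A_le: "A k \<le> \<parallel>v (z k)\<parallel>\<^bsub>Y\<^esub>" if k: "k < n" for k
  proof -
    have lin': "linear_op K W (scalars K) (\<lambda>w. \<psi> k (v w))"
      using linear_op_comp[OF lin \<psi>_lin[OF k]] by (simp add: comp_def)
    have "\<psi> k (v (z k)) = (\<Sum>j\<in>J. c k j * \<psi> k (v (x j)))"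
      unfolding z_def
      by (rule W.linear_op_combination[OF lin' banach_space_scalars[OF K] J cK[OF k] x])
    also have "\<dots> = (\<Sum>j\<in>J. complex_of_real (g k j powr q))"
    proof (rule sum.cong[OF refl])
      fix j assume j: "j \<in> J"
      have "cnj (sgn w) * w = complex_of_real (cmod w)" for w
        by (cases "w = 0") (simp_all add: sgn_eq mult.commute[of "cnj w"] complex_norm_square[symmetric] power2_eq_square)
      then have "c k j * \<psi> k (v (x j)) = complex_of_real (g k j powr (q - 1) * g k j)"
        by (simp add: c_def g_def mult.assoc)
      also have "g k j powr (q - 1) * g k j = g k j powr q"
        using g0[OF j] powr_mult_base[of "g k j" "q - 1"] by (simp add: mult.commute)
      finally show "c k j * \<psi> k (v (x j)) = complex_of_real (g k j powr q)" .
    qed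
    also have "\<dots> = complex_of_real (A k)" by (simp add: A_def)
    finally have "A k = cmod (\<psi> k (v (z k)))" using A0 by simp
    also have "\<dots> \<le> \<parallel>v (z k)\<parallel>\<^bsub>Y\<^esub>"
      by (rule Y.dual_ball_bound[OF K \<psi>[OF k] vY[OF zW[OF k]]])
    finally show ?thesis .
  qed
  (* If A k = 0, then also t k = 0, and the term of index k drops out on both sides below. *)
  define t where "t k = A k powr (- (p * (1 - 1 / r))) / real n" for k
  (* The value of B is M powr (p / r). *)
  define B where "B = M powr (p / q) * M"
  have "B > 0" using \<open>M > 0\<close> by (simp add: B_def)
  have "1 / r \<le> 1" using r by simp
  then have r': "0 \<le> 1 - 1 / r" "1 / p + 1 / q + (1 - 1 / r) = 1" using pqr by linarith+
  have z_bound: "(\<Sum>k<n. t k * \<parallel>v (z k)\<parallel>\<^bsub>Y\<^esub> powr p) \<le> C * B"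
  proof -
    let ?w = "\<lambda>k. complex_of_real (t k powr (1 / p)) \<odot>\<^bsub>W\<^esub> z k"
    have t0: "t k \<ge> 0" for k by (simp add: t_def)
    have "(\<Sum>k<n. \<parallel>v (?w k)\<parallel>\<^bsub>Y\<^esub> powr p) \<le> C * B"
    proof (rule finitely_summingD[OF fs _ _ \<open>B > 0\<close>])
      fix \<phi> assume \<phi>: "\<phi> \<in> dual_ball K W"
      then have l: "linear_op K W (scalars K) \<phi>"
        by (simp add: dual_ball_def bounded_ops_def)
      define E where "E k = (\<Sum>j\<in>J. g k j powr q * cmod (\<phi> (x j)) powr r * \<sigma> j powr (- p))" for k
      have E0: "E k \<ge> 0" for k by (simp add: E_def sum_nonneg)
      have \<phi>z: "cmod (\<phi> (z k)) \<le> E k powr (1 / p) * M powr (1 / q) * A k powr (1 - 1 / r)"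
        if k: "k < n" for k
      proof -
        have "\<phi> (z k) = (\<Sum>j\<in>J. c k j * \<phi> (x j))"
          unfolding z_def
          by (rule W.linear_op_combination[OF l banach_space_scalars[OF K] J cK[OF k] x])
        also have "cmod \<dots> \<le> (\<Sum>j\<in>J. cmod (c k j * \<phi> (x j)))" by (rule norm_sum)
        also have "\<dots> \<le> (\<Sum>j\<in>J. (g k j powr q * cmod (\<phi> (x j)) powr r * \<sigma> j powr (- p)) powr (1 / p)
            * (cmod (\<phi> (x j)) powr r) powr (1 / q) * (g k j powr q) powr (1 - 1 / r))"
        proof (rule sum_mono)
          fix j assume j: "j \<in> J"
          have "cmod (c k j) \<le> g k j powr (q - 1) / \<sigma> j"
            using \<sigma>(1)[OF j] by (simp add: c_def norm_mult norm_divide norm_sgn)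
          then have "cmod (c k j * \<phi> (x j)) \<le> g k j powr (q - 1) / \<sigma> j * cmod (\<phi> (x j))"
            unfolding norm_mult by (rule mult_right_mono) simp
          also have "\<dots> = g k j powr (q / p + q * (1 - 1 / r)) * cmod (\<phi> (x j)) powr (r / p + r / q) * \<sigma> j powr (- 1)"
          proof -
            have "q / p + q * (1 - 1 / r) = q - 1" using q unfolding pqr by (simp add: field_simps)
            then show ?thesis using rp \<sigma>(1)[OF j] by (simp add: powr_minus_divide)
          qed
          also have "\<dots> = (g k j powr q * cmod (\<phi> (x j)) powr r * \<sigma> j powr (- p)) powr (1 / p)
            * (cmod (\<phi> (x j)) powr r) powr (1 / q) * (g k j powr q) powr (1 - 1 / r)"
            using p by (simp add: powr_mult powr_powr powr_add)
          finally show "cmod (c k j * \<phi> (x j)) \<le> \<dots>" .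
        qed
        also have "\<dots> \<le> E k powr (1 / p) * (\<Sum>j\<in>J. cmod (\<phi> (x j)) powr r) powr (1 / q) * A k powr (1 - 1 / r)"
          unfolding E_def A_def using p q r' by (intro Holder_three_sum) auto
        also have "\<dots> \<le> E k powr (1 / p) * M powr (1 / q) * A k powr (1 - 1 / r)"
          using weak[OF \<phi>] q by (intro mult_right_mono mult_left_mono powr_mono2 sum_nonneg) auto
        finally show ?thesis .
      qed
      have "(\<Sum>k<n. cmod (\<phi> (?w k)) powr p) = (\<Sum>k<n. t k * cmod (\<phi> (z k)) powr p)"
        using W.linear_op_scaled_powr[OF l banach_space_scalars[OF K] t0 KR _ zW] p
        by (intro sum.cong) simp_all
      also have "\<dots> \<le> (\<Sum>k<n. E k / real n * M powr (p / q))"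
      proof (rule sum_mono)
        fix k assume "k \<in> {..<n}"
        then have k: "k < n" by simp
        have "cmod (\<phi> (z k)) powr p \<le> (E k powr (1 / p) * M powr (1 / q) * A k powr (1 - 1 / r)) powr p"
          using \<phi>z[OF k] p by (intro powr_mono2) auto
        also have "\<dots> = E k * M powr (p / q) * A k powr (p * (1 - 1 / r))"
          using p E0[of k] by (simp add: powr_mult powr_powr mult.commute)
        finally have "t k * cmod (\<phi> (z k)) powr p \<le> t k * (E k * M powr (p / q) * A k powr (p * (1 - 1 / r)))"
          by (intro mult_left_mono t0)
        also have "\<dots> = E k / real n * M powr (p / q) * (A k powr (- (p * (1 - 1 / r))) * A k powr (p * (1 - 1 / r)))"
          by (simp add: t_def)
        also have "\<dots> \<le> E k / real n * M powr (p / q) * 1"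
          using E0[of k] by (intro mult_left_mono) (simp_all add: powr_add[symmetric])
        finally show "t k * cmod (\<phi> (z k)) powr p \<le> E k / real n * M powr (p / q)" by simp
      qed
      also have "\<dots> = (\<Sum>k<n. E k / real n) * M powr (p / q)" by (simp add: sum_distrib_right)
      also have "(\<Sum>k<n. E k / real n) = (\<Sum>j\<in>J. cmod (\<phi> (x j)) powr r)"
      proof -
        have "(\<Sum>k<n. E k / real n) = (\<Sum>j\<in>J. \<Sum>k<n. g k j powr q * cmod (\<phi> (x j)) powr r * \<sigma> j powr (- p)) / real n"
          unfolding E_def sum_divide_distrib[symmetric] by (subst sum.swap) (rule refl)
        also have "(\<Sum>j\<in>J. \<Sum>k<n. g k j powr q * cmod (\<phi> (x j)) powr r * \<sigma> j powr (- p))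
          = (\<Sum>j\<in>J. real n * cmod (\<phi> (x j)) powr r)"
        proof (rule sum.cong[OF refl])
          fix j assume j: "j \<in> J"
          show "(\<Sum>k<n. g k j powr q * cmod (\<phi> (x j)) powr r * \<sigma> j powr (- p)) = real n * cmod (\<phi> (x j)) powr r"
            using g_avg[OF j] \<sigma>(1)[OF j] by (simp add: sum_distrib_right[symmetric] powr_minus)
        qed
        finally show ?thesis using n by (simp add: sum_distrib_left[symmetric])
      qed
      also have "(\<Sum>j\<in>J. cmod (\<phi> (x j)) powr r) * M powr (p / q) \<le> M * M powr (p / q)"
        by (intro mult_right_mono weak[OF \<phi>]) simp
      finally show "(\<Sum>k<n. cmod (\<phi> (?w k)) powr p) \<le> B" by (simp add: B_def mult.commute)
    qed (use zW KR in auto)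
    moreover have "(\<Sum>k<n. \<parallel>v (?w k)\<parallel>\<^bsub>Y\<^esub> powr p) = (\<Sum>k<n. t k * \<parallel>v (z k)\<parallel>\<^bsub>Y\<^esub> powr p)"
      using W.linear_op_scaled_powr[OF lin Y t0 KR _ zW] p by (intro sum.cong) simp_all
    ultimately show ?thesis by simp
  qed
  have "S = (\<Sum>k<n. A k / real n)" by (rule A_avg[symmetric])
  also have "\<dots> \<le> (\<Sum>k<n. (t k * \<parallel>v (z k)\<parallel>\<^bsub>Y\<^esub> powr p) powr (1 / p) * (1 / real n) powr (1 / q) * (A k / real n) powr (1 - 1 / r))"
  proof (rule sum_mono)
    fix k assume "k \<in> {..<n}"
    then have k: "k < n" by simp
    show "A k / real n \<le> (t k * \<parallel>v (z k)\<parallel>\<^bsub>Y\<^esub> powr p) powr (1 / p) * (1 / real n) powr (1 / q) * (A k / real n) powr (1 - 1 / r)"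
    proof (cases "A k = 0")
      case True
      then show ?thesis by simp
    next
      case False
      have "(t k * \<parallel>v (z k)\<parallel>\<^bsub>Y\<^esub> powr p) powr (1 / p) * (1 / real n) powr (1 / q) * (A k / real n) powr (1 - 1 / r)
        = A k powr (- (1 - 1 / r)) * \<parallel>v (z k)\<parallel>\<^bsub>Y\<^esub> * A k powr (1 - 1 / r)
          * ((1 / real n) powr (1 / p) * (1 / real n) powr (1 / q) * (1 / real n) powr (1 - 1 / r))"
        using p n Y.vnorm_nonneg[OF vY[OF zW[OF k]]]
        by (simp add: t_def powr_mult powr_divide powr_powr)
      also have "(1 / real n) powr (1 / p) * (1 / real n) powr (1 / q) * (1 / real n) powr (1 - 1 / r) = 1 / real n"
        unfolding powr_add[symmetric] r'(2) using n by simp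
      also have "A k powr (- (1 - 1 / r)) * \<parallel>v (z k)\<parallel>\<^bsub>Y\<^esub> * A k powr (1 - 1 / r)
        = \<parallel>v (z k)\<parallel>\<^bsub>Y\<^esub> * (A k powr (- (1 - 1 / r)) * A k powr (1 - 1 / r))" by simp
      also have "A k powr (- (1 - 1 / r)) * A k powr (1 - 1 / r) = 1"
        unfolding powr_add[symmetric] using False by simp
      finally show ?thesis using A_le[OF k] by (simp add: divide_right_mono)
    qed
  qed
  also have "\<dots> \<le> (\<Sum>k<n. t k * \<parallel>v (z k)\<parallel>\<^bsub>Y\<^esub> powr p) powr (1 / p) * (\<Sum>k<n. 1 / real n) powr (1 / q) * (\<Sum>k<n. A k / real n) powr (1 - 1 / r)"
    using p q r' A0 by (intro Holder_three_sum) (auto simp: t_def)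
  also have "\<dots> = (\<Sum>k<n. t k * \<parallel>v (z k)\<parallel>\<^bsub>Y\<^esub> powr p) powr (1 / p) * S powr (1 - 1 / r)"
    using n by (simp add: A_avg)
  also have "\<dots> \<le> (C * B) powr (1 / p) * S powr (1 - 1 / r)"
    using z_bound p by (intro mult_right_mono powr_mono2 sum_nonneg) (auto simp: t_def)
  finally have "S \<le> (C * B) powr (1 / p) * S powr (1 - 1 / r)" .
  moreover have "S = S powr (1 / r) * S powr (1 - 1 / r)"
    using \<open>S > 0\<close> by (simp add: powr_add[symmetric])
  ultimately have "S powr (1 / r) \<le> (C * B) powr (1 / p)"
    using \<open>S > 0\<close> by (metis mult_le_cancel_right_pos powr_gt_zero less_numeral_extra(3))
  then have "(S powr (1 / r)) powr r \<le> ((C * B) powr (1 / p)) powr r"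
    using r by (intro powr_mono2) auto
  then have "S \<le> (C * B) powr (r / p)"
    using r \<open>S > 0\<close> by (simp add: powr_powr)
  also have "\<dots> = C powr (r / p) * (M powr (r / q + r / p))"
    using p \<open>C > 0\<close> \<open>M > 0\<close> by (simp add: B_def powr_mult powr_powr powr_add)
  also have "r / q + r / p = 1" using rp by simp
  finally show ?thesis using \<open>M > 0\<close> \<sigma>(3) by (simp add: S_def)
qed

text \<open>
  Members of the family that \<open>u \<circ> v\<close> annihilates are discarded first, since domination requires
  nonzero images.
\<close>

lemma finitely_summing_comp:
  assumes K: "K = \<real> \<or> K = UNIV"
    and p: "p > 1" and q: "q > 1" and r: "r \<ge> 1" and pqr: "1 / r = 1 / p + 1 / q"
    and W: "banach_space K W" and Y: "banach_space K Y" and Z: "banach_space K Z"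
    and v: "linear_op K W Y v" "finitely_summing K p W Y v C" "C > 0"
    and u: "linear_op K Y Z u" "finitely_summing K q Y Z u D" "D > 0"
  shows "finitely_summing K r W Z (u \<circ> v) ((4 * D) powr (r / q) * C powr (r / p))"
  unfolding finitely_summing_def comp_def
proof (intro allI impI)
  fix I :: "nat set" and x M
  assume I: "finite I" and xW: "\<forall>i\<in>I. x i \<in> carrier W" and M: "M > (0 :: real)"
    and weak: "\<forall>\<phi>\<in>dual_ball K W. (\<Sum>i\<in>I. cmod (\<phi> (x i)) powr r) \<le> M"
  interpret Z: banach_space K Z by fact
  have vY: "v (x j) \<in> carrier Y" if "j \<in> I" for j
    using v(1) xW that by (auto simp: linear_op_def)
  have uv0: "\<parallel>u (v (x j))\<parallel>\<^bsub>Z\<^esub> \<ge> 0" if "j \<in> I" for j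
    using u(1) vY[OF that] by (intro Z.vnorm_nonneg) (auto simp: linear_op_def)
  define J where "J = {j \<in> I. \<parallel>u (v (x j))\<parallel>\<^bsub>Z\<^esub> > 0}"
  have J: "finite J" "J \<subseteq> I" using I by (auto simp: J_def)
  have Jpos: "\<parallel>u (v (x j))\<parallel>\<^bsub>Z\<^esub> > 0" if "j \<in> J" for j using that by (simp add: J_def)
  have JW: "x j \<in> carrier W" and JY: "v (x j) \<in> carrier Y" if "j \<in> J" for j
    using that J(2) xW vY by auto
  have Jweak: "(\<Sum>j\<in>J. cmod (\<phi> (x j)) powr r) \<le> M" if "\<phi> \<in> dual_ball K W" for \<phi>
  proof -
    have "(\<Sum>j\<in>J. cmod (\<phi> (x j)) powr r) \<le> (\<Sum>j\<in>I. cmod (\<phi> (x j)) powr r)"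
      using I J(2) by (intro sum_mono2) auto
    also have "\<dots> \<le> M" using weak that by blast
    finally show ?thesis .
  qed
  have zero: "\<parallel>u (v (x j))\<parallel>\<^bsub>Z\<^esub> powr r = 0" if "j \<in> I - J" for j
    using that uv0[of j] by (simp add: J_def)
  have "(\<Sum>j\<in>I. \<parallel>u (v (x j))\<parallel>\<^bsub>Z\<^esub> powr r) = (\<Sum>j\<in>J. \<parallel>u (v (x j))\<parallel>\<^bsub>Z\<^esub> powr r)"
    using I J(2) zero by (intro sum.mono_neutral_right) auto
  also have "\<dots> \<le> (4 * D) powr (r / q) * (C powr (r / p) * M)"
  proof (cases "J = {}")
    case True
    then show ?thesis using M by simp
  next
    case False
    have "\<exists>n>0. \<exists>\<psi>. (\<forall>k<n. \<psi> k \<in> dual_ball K Y) \<and> (\<forall>j\<in>J. \<parallel>u (v (x j))\<parallel>\<^bsub>Z\<^esub> powr q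
        \<le> 4 * D * ((\<Sum>k<n. cmod (\<psi> k (v (x j))) powr q) / real n))"
      by (rule finite_Pietsch_domination[OF K _ u(3) Y Z u(1,2) J(1) False JY Jpos])
        (use q in simp)
    then obtain n \<psi> where n: "n > 0" and \<psi>: "\<And>k. k < n \<Longrightarrow> \<psi> k \<in> dual_ball K Y"
      and dom: "\<And>j. j \<in> J \<Longrightarrow> \<parallel>u (v (x j))\<parallel>\<^bsub>Z\<^esub> powr q
        \<le> 4 * D * ((\<Sum>k<n. cmod (\<psi> k (v (x j))) powr q) / real n)"
      by blast
    define b where "b j = (\<Sum>k<n. cmod (\<psi> k (v (x j))) powr q) / real n" for j
    have b0: "b j > 0" if "j \<in> J" for j
    proof -
      have "0 < \<parallel>u (v (x j))\<parallel>\<^bsub>Z\<^esub> powr q" using Jpos[OF that] by simp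
      also have "\<dots> \<le> 4 * D * b j" using dom[OF that] by (simp add: b_def)
      finally show ?thesis using u(3) by (simp add: zero_less_mult_iff)
    qed
    have "\<parallel>u (v (x j))\<parallel>\<^bsub>Z\<^esub> powr r \<le> (4 * D) powr (r / q) * b j powr (r / q)" if "j \<in> J" for j
    proof -
      have "\<parallel>u (v (x j))\<parallel>\<^bsub>Z\<^esub> powr r = (\<parallel>u (v (x j))\<parallel>\<^bsub>Z\<^esub> powr q) powr (r / q)"
        using q by (simp add: powr_powr)
      also have "\<dots> \<le> (4 * D * b j) powr (r / q)"
        using dom[OF that] q r by (intro powr_mono2) (simp_all add: b_def)
      also have "\<dots> = (4 * D) powr (r / q) * b j powr (r / q)"
        using u(3) b0[OF that] by (simp add: powr_mult)
      finally show ?thesis .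
    qed
    then have "(\<Sum>j\<in>J. \<parallel>u (v (x j))\<parallel>\<^bsub>Z\<^esub> powr r) \<le> (4 * D) powr (r / q) * (\<Sum>j\<in>J. b j powr (r / q))"
      unfolding sum_distrib_left by (rule sum_mono)
    also have "(\<Sum>j\<in>J. b j powr (r / q)) \<le> C powr (r / p) * M"
      by (rule finite_factorization_estimate[where x = x and \<psi> = \<psi> and b = b, OF K p q r pqr W Y v J(1) JW M Jweak n \<psi> b_def b0])
    then have "(4 * D) powr (r / q) * (\<Sum>j\<in>J. b j powr (r / q))
        \<le> (4 * D) powr (r / q) * (C powr (r / p) * M)"
      by (rule mult_left_mono) simp
    finally show ?thesis .
  qed
  finally show "(\<Sum>j\<in>I. \<parallel>u (v (x j))\<parallel>\<^bsub>Z\<^esub> powr r)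
      \<le> (4 * D) powr (r / q) * C powr (r / p) * M" by (simp add: mult.assoc)
qed

theorem summing_ops_comp:
  assumes K: "K = \<real> \<or> K = UNIV"
    and p: "p > 1" and q: "q > 1" and r: "r \<ge> 1" and pqr: "1 / r = 1 / p + 1 / q"
    and W: "banach_space K W" and Y: "banach_space K Y" and Z: "banach_space K Z"
    and v: "v \<in> summing_ops K p W Y" and u: "u \<in> summing_ops K q Y Z"
  shows "u \<circ> v \<in> summing_ops K r W Z"
proof -
  have v_bd: "v \<in> bounded_ops K W Y" and u_bd: "u \<in> bounded_ops K Y Z"
    using v u by (simp_all add: summing_ops_def)
  then have v_lin: "linear_op K W Y v" and u_lin: "linear_op K Y Z u"
    by (simp_all add: bounded_ops_def)
  obtain C where C: "C > 0" "finitely_summing K p W Y v C"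
    by (rule summing_ops_finitely_summing[OF K _ W Y v]) (use p in simp)
  obtain D where D: "D > 0" "finitely_summing K q Y Z u D"
    by (rule summing_ops_finitely_summing[OF K _ Y Z u]) (use q in simp)
  have "u \<circ> v \<in> bounded_ops K W Z"
    using v_bd u_bd linear_op_comp[OF v_lin u_lin]
    by (auto simp: bounded_ops_def intro: continuous_map_compose)
  then show ?thesis
    by (rule finitely_summing_imp_summing)
      (rule finitely_summing_comp[OF K p q r pqr W Y Z v_lin C(2,1) u_lin D(2,1)])
qed

section \<open>Multilinear operators\<close>

lemma multilinear_op_comp:
  assumes "multilinear_op K n X Y T" and "linear_op K Y Z u"
  shows "multilinear_op K n X Z (u \<circ> T)"
proof -
  have "linear_op K V Z (\<lambda>t. u (f t))" if "linear_op K V Y f" for V :: "'a normed_module" and f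
    using linear_op_comp[OF that assms(2)] by (simp add: comp_def)
  moreover have "u \<circ> T \<in> (\<Pi>\<^sub>E i\<in>{1..n}. carrier (X i)) \<rightarrow> carrier Z"
    using assms by (auto simp: multilinear_op_def linear_op_def)
  ultimately show ?thesis using assms(1) by (simp add: multilinear_op_def)
qed

theorem proposition2p1:
  fixes K :: "complex set" and p q r :: real and n :: nat
    and X :: "nat \<Rightarrow> 'x normed_module"
    and Y :: "'y normed_module" and Z :: "'z normed_module"
    and T :: "(nat \<Rightarrow> 'x) \<Rightarrow> 'y" and u :: "'y \<Rightarrow> 'z"
  assumes "K = \<real> \<or> K = UNIV"
    and "1 < p" and "1 < q" and "1 \<le> r" and "1 / r = 1 / p + 1 / q"
    and "\<And>i. i \<in> {1..n} \<Longrightarrow> banach_space K (X i)"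
    and "banach_space K Y" and "banach_space K Z"
    and "T \<in> ideal_factor_ops K
           (summing_ops K p :: 'w normed_module \<Rightarrow> 'y normed_module \<Rightarrow> ('w \<Rightarrow> 'y) set) n X Y"
    and "u \<in> summing_ops K q Y Z"
  shows "u \<circ> T \<in> ideal_factor_ops K
           (summing_ops K r :: 'w normed_module \<Rightarrow> 'z normed_module \<Rightarrow> ('w \<Rightarrow> 'z) set) n X Z"
proof -
  obtain W :: "'w normed_module" and A v where W: "banach_space K W"
    and A: "A \<in> bounded_multilinear_ops K n X W" and v: "v \<in> summing_ops K p W Y"
    and T: "\<And>x. x \<in> (\<Pi>\<^sub>E i\<in>{1..n}. carrier (X i)) \<Longrightarrow> T x = v (A x)"
    and "multilinear_op K n X Y T"
    using assms(9) unfolding ideal_factor_ops_def by blast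
  have "linear_op K Y Z u"
    using assms(10) by (simp add: summing_ops_def bounded_ops_def)
  then have "multilinear_op K n X Z (u \<circ> T)"
    by (rule multilinear_op_comp[OF \<open>multilinear_op K n X Y T\<close>])
  moreover have "u \<circ> v \<in> summing_ops K r W Z"
    by (rule summing_ops_comp[OF assms(1-5) W assms(7,8) v assms(10)])
  moreover have "(u \<circ> T) x = (u \<circ> v) (A x)" if "x \<in> (\<Pi>\<^sub>E i\<in>{1..n}. carrier (X i))" for x
    using T[OF that] by simp
  ultimately show ?thesis
    using W A unfolding ideal_factor_ops_def by blast
qed

end
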